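(* Let $m\in\mathbb{N}$, let $f:\mathbb{R}^{m}\to\mathbb{R}$ be a function in $BB(\mathbb{R}^{m})$, and let $E$ be the set of points $p\in\mathbb{R}^{m}$ at which $f$ is not continuous. If $E$ is a very small subset of $\mathbb{R}^{m}$, then $f\in RI(\mathbb{R}^{m})$.
   Context: For $m\in\mathbb{N}=\{1,2,\dots\}$ and an integer $k\ge 0$, $D_{k}(\mathbb{R}^{m})$ is the collection of all semiclosed dyadic cubes $\prod_{j=1}^{m}[n_{j}2^{-k},(n_{j}+1)2^{-k})$ with $n_{1},\dots,n_{m}\in\mathbb{Z}$; the elements of $\bigcup_{k\ge0}D_k(\mathbb{R}^m)$ are the dyadic $m$-cubes. $BB(\mathbb{R}^{m})$ is the set of bounded functions $f:\mathbb{R}^{m}\to\mathbb{R}$ which vanish outside some bounded set. For $f\in BB(\mathbb{R}^{m})$ set $U_{k}(f)=2^{-km}\sum_{I\in D_{k}(\mathbb{R}^{m})}\sup_{p\in I}f(p)$ and $L_{k}(f)=2^{-km}\sum_{I\in D_{k}(\mathbb{R}^{m})}\inf_{p\in I}f(p)$ (only finitely many terms are non-zero). The sequences $U_k(f)$ and $L_k(f)$ are bounded and, respectively, non-increasing and non-decreasing in $k$, so they converge. A function $f\in BB(\mathbb{R}^{m})$ is (dyadically) Riemann integrable, written $f\in RI(\mathbb{R}^{m})$, if $\lim_{k\to\infty}U_{k}(f)=\lim_{k\to\infty}L_{k}(f)$. A set $E\subset\mathbb{R}^{m}$ is a very small subset of $\mathbb{R}^{m}$ if, for each $\epsilon>0$,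 there exists a finite collection $J_{1},\dots,J_{N}$ of dyadic $m$-cubes such that $E\subset\bigcup_{n=1}^{N}J_{n}$ and $\sum_{n=1}^{N}|J_{n}|_{m}<\epsilon$, where $|J|_{m}=2^{-km}$ for $J\in D_{k}(\mathbb{R}^{m})$. *)

theory Defs
  imports "HOL-Analysis.Analysis"
begin

definition dyadic_cube :: "nat \<Rightarrow> ('m::finite \<Rightarrow> int) \<Rightarrow> (real ^ 'm) set" where
  "dyadic_cube k n =
    {x. \<forall>j. of_int (n j) / 2 ^ k \<le> x $ j \<and> x $ j < (of_int (n j) + 1) / 2 ^ k}"

definition dyadic_cubes_level :: "nat \<Rightarrow> (real ^ 'm::finite) set set" where
  "dyadic_cubes_level k = range (dyadic_cube k)"

definition dyadic_cubes :: "(real ^ 'm::finite) set set" where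
  "dyadic_cubes = (\<Union>k. dyadic_cubes_level k)"

text \<open>The level of a dyadic cube is determined by the cube as a set, so the description below
  is proper; see \<open>dyadic_volume_eq\<close>.\<close>

definition dyadic_volume :: "(real ^ 'm::finite) set \<Rightarrow> real" where
  "dyadic_volume J = (THE v. \<exists>k. J \<in> dyadic_cubes_level k \<and> v = 1 / 2 ^ (k * CARD('m)))"

definition BB :: "(real ^ 'm::finite \<Rightarrow> real) set" where
  "BB = {f. bounded (range f) \<and> (\<exists>S. bounded S \<and> (\<forall>p. p \<notin> S \<longrightarrow> f p = 0))}"

text \<open>For \<open>f \<in> BB\<close> only finitely many terms of the following sums are non-zero, and the
  suprema and infima are those of bounded non-empty sets of reals.\<close>

definition upper_dyadic_sum :: "nat \<Rightarrow> (real ^ 'm::finite \<Rightarrow> real) \<Rightarrow> real" where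
  "upper_dyadic_sum k f =
    1 / 2 ^ (k * CARD('m)) * (\<Sum>\<^sub>\<infinity>I\<in>dyadic_cubes_level k. SUP p\<in>I. f p)"

definition lower_dyadic_sum :: "nat \<Rightarrow> (real ^ 'm::finite \<Rightarrow> real) \<Rightarrow> real" where
  "lower_dyadic_sum k f =
    1 / 2 ^ (k * CARD('m)) * (\<Sum>\<^sub>\<infinity>I\<in>dyadic_cubes_level k. INF p\<in>I. f p)"

definition RI :: "(real ^ 'm::finite \<Rightarrow> real) set" where
  "RI = {f \<in> BB. \<exists>l. (\<lambda>k. upper_dyadic_sum k f) \<longlonglongrightarrow> l \<and> (\<lambda>k. lower_dyadic_sum k f) \<longlonglongrightarrow> l}"

definition very_small :: "(real ^ 'm::finite) set \<Rightarrow> bool" where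
  "very_small E \<longleftrightarrow>
    (\<forall>\<epsilon>>0. \<exists>(N::nat) J. (\<forall>n\<in>{1..N}. J n \<in> dyadic_cubes) \<and> E \<subseteq> (\<Union>n\<in>{1..N}. J n) \<and>
      (\<Sum>n=1..N. dyadic_volume (J n)) < \<epsilon>)"

lemma dyadic_cube_neq_of_less:
  assumes "k < l"
  shows "dyadic_cube k n \<noteq> dyadic_cube l (n' :: 'm::finite \<Rightarrow> int)"
proof
  assume eq: "dyadic_cube k n = dyadic_cube l n'"
  define p q :: "real ^ 'm" where "p = (\<chi> j. of_int (n j) / 2 ^ k)"
    and "q = (\<chi> j. of_int (n j) / 2 ^ k + 1 / 2 ^ l)"
  have "(1::real) / 2 ^ l < 1 / 2 ^ k"
    using assms by (simp add: divide_strict_left_mono)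
  then have "p \<in> dyadic_cube k n" "q \<in> dyadic_cube k n"
    by (auto simp: dyadic_cube_def p_def q_def add_divide_distrib)
  then have "p \<in> dyadic_cube l n'" "q \<in> dyadic_cube l n'"
    by (simp_all add: eq)
  then have "of_int (n' j) / 2 ^ l \<le> p $ j" "q $ j < of_int (n' j) / 2 ^ l + 1 / 2 ^ l" for j
    by (auto simp: dyadic_cube_def add_divide_distrib)
  moreover have "q $ j = p $ j + 1 / 2 ^ l" for j
    by (simp add: p_def q_def)
  ultimately show False
    by (metis add_less_cancel_right linorder_not_less)
qed

lemma dyadic_level_unique:
  assumes "J \<in> dyadic_cubes_level k" "J \<in> dyadic_cubes_level l"
  shows "k = l"
  using assms dyadic_cube_neq_of_less unfolding dyadic_cubes_level_def
  by (metis imageE linorder_neqE_nat)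

lemma dyadic_volume_eq:
  fixes J :: "(real ^ 'm::finite) set"
  assumes "J \<in> dyadic_cubes_level k"
  shows "dyadic_volume J = 1 / 2 ^ (k * CARD('m))"
  unfolding dyadic_volume_def using assms dyadic_level_unique by (intro the_equality) blast+

end

theory Submission
  imports Defs
begin

text \<open>The dyadic sums are integrals of step functions. For a point \<open>x\<close> and a level \<open>k\<close> there is
  exactly one level-\<open>k\<close> cube containing \<open>x\<close>, and the function \<open>dyadic_sup k f\<close> that assigns to \<open>x\<close>
  the supremum of \<open>f\<close> over that cube has the upper dyadic sum as its integral. All these step
  functions are bounded by the same multiple of the indicator of one box, and wherever \<open>f\<close> is
  continuous they converge to \<open>f\<close>, because the cube around the point shrinks to that point. A very
  small set is Lebesgue negligible, so if the discontinuity set is very small, the convergence holds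
  almost everywhere, and dominated convergence shows that the upper sums tend to the integral of
  \<open>f\<close> (lemma \<open>upper_dyadic_sum_tendsto_integral\<close>). The infimum of \<open>f\<close> is minus the supremum of
  \<open>- f\<close>, so the lower sums tend to minus the integral of \<open>- f\<close>, which is the same number.\<close>

section \<open>Dyadic cubes as a partition into small sets\<close>

definition dyadic_index :: "nat \<Rightarrow> real ^ 'm::finite \<Rightarrow> 'm \<Rightarrow> int" where
  "dyadic_index k x = (\<lambda>j. \<lfloor>2 ^ k * x $ j\<rfloor>)"

lemma mem_dyadic_cube_iff: "x \<in> dyadic_cube k n \<longleftrightarrow> dyadic_index k x = n"
proof -
  have "\<lfloor>2 ^ k * x $ j\<rfloor> = n j \<longleftrightarrow>
      of_int (n j) / 2 ^ k \<le> x $ j \<and> x $ j < (of_int (n j) + 1) / 2 ^ k" for j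
    by (simp add: floor_eq_iff field_simps)
  then show ?thesis
    by (simp add: dyadic_cube_def dyadic_index_def fun_eq_iff)
qed

lemma dyadic_cube_nonempty: "dyadic_cube k n \<noteq> {}"
proof -
  have "dyadic_index k (\<chi> j. of_int (n j) / 2 ^ k) = n"
    by (simp add: dyadic_index_def)
  then show ?thesis
    by (metis mem_dyadic_cube_iff empty_iff)
qed

lemma inj_dyadic_cube: "inj (dyadic_cube k)"
proof (rule injI)
  fix n n' :: "'a \<Rightarrow> int"
  assume "dyadic_cube k n = dyadic_cube k n'"
  moreover obtain x where "x \<in> dyadic_cube k n"
    using dyadic_cube_nonempty by blast
  ultimately show "n = n'"
    by (metis mem_dyadic_cube_iff)
qed

lemma dyadic_cube_component_dist:
  assumes "x \<in> dyadic_cube k n" "y \<in> dyadic_cube k n"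
  shows "\<bar>x $ j - y $ j\<bar> \<le> 1 / 2 ^ k"
proof -
  have "of_int (n j) / 2 ^ k \<le> z $ j \<and> z $ j < of_int (n j) / 2 ^ k + 1 / 2 ^ k"
    if "z \<in> dyadic_cube k n" for z
    using that by (simp add: dyadic_cube_def add_divide_distrib)
  from this[OF assms(1)] this[OF assms(2)] show ?thesis
    by linarith
qed

lemma dyadic_cube_dist:
  fixes x y :: "real ^ 'm::finite"
  assumes "x \<in> dyadic_cube k n" "y \<in> dyadic_cube k n"
  shows "dist x y \<le> CARD('m) / 2 ^ k"
proof -
  have "norm (x - y) \<le> (\<Sum>j\<in>UNIV. \<bar>(x - y) $ j\<bar>)"
    by (rule norm_le_l1_cart)
  also have "\<dots> \<le> (\<Sum>j\<in>(UNIV :: 'm set). 1 / 2 ^ k)"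
    using dyadic_cube_component_dist[OF assms] by (intro sum_mono) simp
  finally show ?thesis
    by (simp add: dist_norm)
qed

lemma finite_dyadic_cubes_meeting_bounded:
  fixes S :: "(real ^ 'm::finite) set"
  assumes "bounded S"
  shows "finite {n. dyadic_cube k n \<inter> S \<noteq> {}}"
proof -
  obtain R where R: "\<And>x. x \<in> S \<Longrightarrow> norm x \<le> R"
    using assms by (auto simp: bounded_iff)
  have "{n. dyadic_cube k n \<inter> S \<noteq> {}} \<subseteq> PiE UNIV (\<lambda>_. {\<lfloor>- (2 ^ k * R)\<rfloor>..\<lfloor>2 ^ k * R\<rfloor>})"
  proof
    fix n assume "n \<in> {n. dyadic_cube k n \<inter> S \<noteq> {}}"
    then obtain x where x: "x \<in> S" and "x \<in> dyadic_cube k n"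
      by blast
    then have n: "n = dyadic_index k x"
      by (simp add: mem_dyadic_cube_iff)
    have "\<lfloor>- (2 ^ k * R)\<rfloor> \<le> n j \<and> n j \<le> \<lfloor>2 ^ k * R\<rfloor>" for j
    proof -
      have "\<bar>x $ j\<bar> \<le> R"
        using R[OF x] component_le_norm_cart order_trans by blast
      then have "\<bar>2 ^ k * x $ j\<bar> \<le> 2 ^ k * R"
        by (simp add: abs_mult)
      then show ?thesis
        unfolding n dyadic_index_def by (intro conjI floor_mono) linarith+
    qed
    then show "n \<in> PiE UNIV (\<lambda>_. {\<lfloor>- (2 ^ k * R)\<rfloor>..\<lfloor>2 ^ k * R\<rfloor>})"
      by auto
  qed
  then show ?thesis
    by (rule finite_subset) (auto intro: finite_PiE)
qed

section \<open>Lebesgue measure of dyadic cubes\<close>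

text \<open>A dyadic cube lies between an open and a closed box with the same corners, and these differ
  only in a negligible set.\<close>

lemma
  fixes n :: "'m::finite \<Rightarrow> int"
  shows dyadic_cube_lmeasurable: "dyadic_cube k n \<in> lmeasurable"
    and measure_dyadic_cube: "measure lebesgue (dyadic_cube k n) = 1 / 2 ^ (k * CARD('m))"
proof -
  define a b :: "real ^ 'm" where "a = (\<chi> j. of_int (n j) / 2 ^ k)"
    and "b = (\<chi> j. (of_int (n j) + 1) / 2 ^ k)"
  have "dyadic_cube k n \<subseteq> cbox a b" "box a b \<subseteq> dyadic_cube k n"
    by (auto simp: dyadic_cube_def a_def b_def mem_box_cart less_imp_le)
  then have "(cbox a b - dyadic_cube k n) \<union> (dyadic_cube k n - cbox a b) \<subseteq> cbox a b - box a b"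
    by blast
  then have neg: "negligible ((cbox a b - dyadic_cube k n) \<union> (dyadic_cube k n - cbox a b))"
    using negligible_frontier_interval negligible_subset by blast
  show "dyadic_cube k n \<in> lmeasurable"
    using lmeasurable_negligible_symdiff[OF lmeasurable_cbox neg] .
  have side: "b $ j - a $ j = 1 / 2 ^ k" for j
    by (simp add: a_def b_def add_divide_distrib)
  then have "a $ j \<le> b $ j" for j
    by (metis diff_ge_0_iff_ge zero_le_divide_1_iff zero_le_power zero_le_numeral)
  then have ne: "cbox a b \<noteq> {}"
    by (simp add: interval_ne_empty_cart)
  have "measure lebesgue (dyadic_cube k n) = measure lebesgue (cbox a b)"
    using measure_negligible_symdiff[OF lmeasurable_cbox neg] .
  also have "\<dots> = (1 / 2 ^ k) ^ CARD('m)"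
    using content_cbox_cart[OF ne] side by simp
  finally show "measure lebesgue (dyadic_cube k n) = 1 / 2 ^ (k * CARD('m))"
    by (simp add: power_divide power_mult)
qed

lemma very_small_imp_negligible:
  fixes E :: "(real ^ 'm::finite) set"
  assumes "very_small E"
  shows "negligible E"
  unfolding negligible_outer_le
proof (intro allI impI)
  fix e :: real assume "e > 0"
  then obtain N :: nat and J where J: "\<And>n. n \<in> {1..N} \<Longrightarrow> J n \<in> dyadic_cubes"
    and cover: "E \<subseteq> (\<Union>n\<in>{1..N}. J n)" and small: "(\<Sum>n=1..N. dyadic_volume (J n)) < e"
    using assms unfolding very_small_def by meson
  have J_meas: "J n \<in> lmeasurable \<and> measure lebesgue (J n) = dyadic_volume (J n)"
    if n: "n \<in> {1..N}" for n
  proof -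
    obtain k where k: "J n \<in> dyadic_cubes_level k"
      using J[OF n] by (auto simp: dyadic_cubes_def)
    then obtain i where "J n = dyadic_cube k i"
      by (auto simp: dyadic_cubes_level_def)
    then show ?thesis
      using dyadic_volume_eq[OF k] by (simp add: dyadic_cube_lmeasurable measure_dyadic_cube)
  qed
  have "measure lebesgue (\<Union>n\<in>{1..N}. J n) \<le> (\<Sum>n=1..N. measure lebesgue (J n))"
    using J_meas by (intro measure_UNION_le) auto
  also have "\<dots> = (\<Sum>n=1..N. dyadic_volume (J n))"
    using J_meas by simp
  finally have "measure lebesgue (\<Union>n\<in>{1..N}. J n) \<le> e"
    using small by linarith
  moreover have "(\<Union>n\<in>{1..N}. J n) \<in> lmeasurable"
    using J_meas by (intro fmeasurable.finite_UN) auto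
  ultimately show "\<exists>T. E \<subseteq> T \<and> T \<in> lmeasurable \<and> measure lebesgue T \<le> e"
    using cover by blast
qed

section \<open>Upper sums as integrals of step functions\<close>

definition dyadic_sup :: "nat \<Rightarrow> (real ^ 'm::finite \<Rightarrow> real) \<Rightarrow> real ^ 'm \<Rightarrow> real" where
  "dyadic_sup k f x = (SUP p\<in>dyadic_cube k (dyadic_index k x). f p)"

lemma SUP_dyadic_cube_eq_0:
  assumes "\<And>p. p \<in> dyadic_cube k n \<Longrightarrow> f p = 0"
  shows "(SUP p\<in>dyadic_cube k n. f p) = (0::real)"
proof -
  have "f ` dyadic_cube k n = {0}"
    using assms dyadic_cube_nonempty[of k n] by auto
  then show ?thesis
    by simp
qed

text \<open>Only the finitely many cubes that meet the support of \<open>f\<close> contribute, so both the infinite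
  sum and the step function reduce to the same finite sum over cubes.\<close>

lemma has_integral_dyadic_sup:
  fixes f :: "real ^ 'm::finite \<Rightarrow> real"
  assumes "bounded S" and supp: "\<And>p. p \<notin> S \<Longrightarrow> f p = 0"
  shows "(dyadic_sup k f has_integral upper_dyadic_sum k f) UNIV"
proof -
  define F where "F = {n. dyadic_cube k n \<inter> S \<noteq> {}}"
  define s where "s n = (SUP p\<in>dyadic_cube k n. f p)" for n
  have fin: "finite F"
    unfolding F_def using \<open>bounded S\<close> by (rule finite_dyadic_cubes_meeting_bounded)
  have s0: "s n = 0" if "n \<notin> F" for n
    unfolding s_def using that supp by (intro SUP_dyadic_cube_eq_0) (auto simp: F_def)
  have "dyadic_sup k f = (\<lambda>x. \<Sum>n\<in>F. s n * indicator (dyadic_cube k n) x)"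
  proof
    fix x
    have "(\<Sum>n\<in>F. s n * indicator (dyadic_cube k n) x) = (\<Sum>n\<in>F. if n = dyadic_index k x then s n else 0)"
      by (intro sum.cong) (auto simp: indicator_def mem_dyadic_cube_iff)
    also have "\<dots> = s (dyadic_index k x)"
      using fin s0 by simp
    finally show "dyadic_sup k f x = (\<Sum>n\<in>F. s n * indicator (dyadic_cube k n) x)"
      by (simp add: dyadic_sup_def s_def)
  qed
  moreover have "((\<lambda>x. \<Sum>n\<in>F. s n * indicator (dyadic_cube k n) x) has_integral
      (\<Sum>n\<in>F. s n * measure lebesgue (dyadic_cube k n))) UNIV"
    using dyadic_cube_lmeasurable
    by (intro has_integral_sum fin has_integral_mult_right) (simp flip: lmeasurable_iff_has_integral)
  moreover have "(\<Sum>n\<in>F. s n * measure lebesgue (dyadic_cube k n)) = upper_dyadic_sum k f"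
  proof -
    have "(\<Sum>\<^sub>\<infinity>I\<in>dyadic_cubes_level k. SUP p\<in>I. f p) = infsum s UNIV"
      unfolding dyadic_cubes_level_def infsum_reindex[OF inj_dyadic_cube]
      by (simp add: o_def s_def[abs_def])
    also have "\<dots> = infsum s F"
      using s0 by (intro infsum_cong_neutral) auto
    also have "\<dots> = sum s F"
      using fin by simp
    finally show ?thesis
      by (simp add: upper_dyadic_sum_def measure_dyadic_cube sum_divide_distrib)
  qed
  ultimately show ?thesis
    by simp
qed

lemma abs_SUP_le:
  fixes f :: "'a \<Rightarrow> real"
  assumes "A \<noteq> {}" "\<And>p. p \<in> A \<Longrightarrow> \<bar>f p - c\<bar> \<le> e"
  shows "\<bar>(SUP p\<in>A. f p) - c\<bar> \<le> e"
proof -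
  obtain a where a: "a \<in> A"
    using assms(1) by blast
  have le: "f p \<le> c + e" "c - e \<le> f p" if "p \<in> A" for p
    using assms(2)[OF that] by linarith+
  have "(SUP p\<in>A. f p) \<le> c + e"
    using assms(1) le by (intro cSUP_least)
  moreover have "c - e \<le> (SUP p\<in>A. f p)"
    using le(2)[OF a] a le(1) by (intro cSUP_upper2[of _ _ a]) (auto intro!: bdd_aboveI2)
  ultimately show ?thesis
    by linarith
qed

lemma dyadic_sup_tendsto:
  fixes f :: "real ^ 'm::finite \<Rightarrow> real"
  assumes "isCont f x"
  shows "(\<lambda>k. dyadic_sup k f x) \<longlonglongrightarrow> f x"
proof (rule metric_LIMSEQ_I)
  fix e :: real assume "e > 0"
  then obtain d where "d > 0" and d: "\<And>y. dist y x < d \<Longrightarrow> dist (f y) (f x) < e / 2"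
    using assms unfolding continuous_at_eps_delta by (meson half_gt_zero)
  have "(\<lambda>k. real CARD('m) * (1 / 2) ^ k) \<longlonglongrightarrow> real CARD('m) * 0"
    by (intro tendsto_intros LIMSEQ_power_zero) simp
  then have "\<forall>\<^sub>F k in sequentially. real CARD('m) * (1 / 2) ^ k < d"
    using \<open>d > 0\<close> by (intro order_tendstoD(2)) auto
  then obtain K where K: "\<And>k. k \<ge> K \<Longrightarrow> CARD('m) / 2 ^ k < d"
    by (auto simp: eventually_sequentially power_divide)
  have "dist (dyadic_sup k f x) (f x) < e" if "k \<ge> K" for k
  proof -
    have "\<bar>f p - f x\<bar> \<le> e / 2" if "p \<in> dyadic_cube k (dyadic_index k x)" for p
    proof -
      have "dist p x \<le> CARD('m) / 2 ^ k"
        using dyadic_cube_dist that mem_dyadic_cube_iff by blast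
      then show ?thesis
        using d[of p] K[OF \<open>k \<ge> K\<close>] by (simp add: dist_real_def)
    qed
    then have "\<bar>dyadic_sup k f x - f x\<bar> \<le> e / 2"
      unfolding dyadic_sup_def using dyadic_cube_nonempty by (intro abs_SUP_le)
    then show ?thesis
      using \<open>e > 0\<close> by (simp add: dist_real_def)
  qed
  then show "\<exists>K. \<forall>k\<ge>K. dist (dyadic_sup k f x) (f x) < e"
    by blast
qed

text \<open>Cubes of every level have side at most 1, so passing from \<open>f\<close> to its step functions
  enlarges the support by at most 1 in each coordinate.\<close>

lemma dyadic_sup_dominated:
  fixes f :: "real ^ 'm::finite \<Rightarrow> real"
  assumes R: "\<And>p. p \<in> S \<Longrightarrow> norm p \<le> R" and supp: "\<And>p. p \<notin> S \<Longrightarrow> f p = 0"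
    and B: "\<And>p. \<bar>f p\<bar> \<le> B"
  shows "\<bar>dyadic_sup k f x\<bar> \<le> B * indicator (cbox (\<chi> j. - (R + 1)) (\<chi> j. R + 1)) x"
proof (cases "x \<in> cbox (\<chi> j. - (R + 1)) (\<chi> j. R + 1)")
  case True
  have "\<bar>dyadic_sup k f x - 0\<bar> \<le> B"
    unfolding dyadic_sup_def using dyadic_cube_nonempty B by (intro abs_SUP_le) auto
  then show ?thesis
    using True by simp
next
  case False
  have "f p = 0" if p: "p \<in> dyadic_cube k (dyadic_index k x)" for p
  proof (rule ccontr)
    assume "f p \<noteq> 0"
    then have norm: "norm p \<le> R"
      using supp R by blast
    have "- (R + 1) \<le> x $ j \<and> x $ j \<le> R + 1" for j
    proof -
      have "\<bar>p $ j - x $ j\<bar> \<le> 1 / 2 ^ k"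
        using dyadic_cube_component_dist p mem_dyadic_cube_iff by blast
      also have "1 / 2 ^ k \<le> (1::real)"
        by simp
      finally show ?thesis
        using component_le_norm_cart[of p j] norm by linarith
    qed
    then show False
      using False by (simp add: mem_box_cart)
  qed
  then have "dyadic_sup k f x = 0"
    unfolding dyadic_sup_def by (rule SUP_dyadic_cube_eq_0)
  then show ?thesis
    using False by simp
qed

section \<open>Convergence of the dyadic sums\<close>

text \<open>Dominated convergence is applied on the set where \<open>f\<close> is continuous; its complement is
  negligible, so restricting the step functions to it does not change their integrals.\<close>

lemma upper_dyadic_sum_tendsto_integral:
  fixes f :: "real ^ 'm::finite \<Rightarrow> real"
  assumes "f \<in> BB" and neg: "negligible {p. \<not> isCont f p}"
  shows "(\<lambda>k. upper_dyadic_sum k f) \<longlonglongrightarrow> integral {p. isCont f p} f"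
proof -
  let ?C = "{p. isCont f p}"
  obtain S where S: "bounded S" and supp: "\<And>p. p \<notin> S \<Longrightarrow> f p = 0"
    using assms(1) by (auto simp: BB_def)
  obtain R where R: "\<And>p. p \<in> S \<Longrightarrow> norm p \<le> R"
    using S by (auto simp: bounded_iff)
  obtain B where B: "\<And>p. \<bar>f p\<bar> \<le> B"
    using assms(1) by (auto simp: BB_def bounded_iff)
  define h :: "real ^ 'm \<Rightarrow> real"
    where "h = (\<lambda>x. B * indicator (cbox (\<chi> j. - (R + 1)) (\<chi> j. R + 1)) x)"
  have spike: "(g has_integral y) UNIV \<longleftrightarrow> (g has_integral y) ?C" for g :: "real ^ 'm \<Rightarrow> real" and y
    by (intro has_integral_spike_set_eq negligible_subset[OF neg]) auto
  have step: "(dyadic_sup k f has_integral upper_dyadic_sum k f) ?C" for k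
    using has_integral_dyadic_sup[OF S supp] by (simp flip: spike)
  have "(h has_integral (B * measure lebesgue (cbox (\<chi> j. - (R + 1)) (\<chi> j. R + 1) :: (real ^ 'm) set))) UNIV"
    unfolding h_def by (intro has_integral_mult_right lmeasurable_iff_has_integral[THEN iffD1] lmeasurable_cbox)
  then have "h integrable_on ?C"
    by (auto simp: integrable_on_def simp flip: spike)
  moreover have "norm (dyadic_sup k f x) \<le> h x" for k x
    unfolding h_def real_norm_def by (rule dyadic_sup_dominated[OF R supp B])
  ultimately have "(\<lambda>k. integral ?C (dyadic_sup k f)) \<longlonglongrightarrow> integral ?C f"
    using step dyadic_sup_tendsto
    by (intro dominated_convergence(2)[where h = h]) (auto intro: has_integral_integrable)
  then show ?thesis
    using integral_unique[OF step] by simp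
qed

lemma lower_dyadic_sum_eq_upper: "lower_dyadic_sum k f = - upper_dyadic_sum k (\<lambda>p. - f p)"
proof -
  have "(INF p\<in>I. f p) = - (SUP p\<in>I. - f p)" for I
    by (simp add: Inf_real_def image_image)
  then show ?thesis
    by (simp add: lower_dyadic_sum_def upper_dyadic_sum_def infsum_uminus)
qed

theorem theorem4p23:
  fixes f :: "real ^ 'm::finite \<Rightarrow> real" and E :: "(real ^ 'm) set"
  assumes "f \<in> BB"
    and "E = {p. \<not> isCont f p}"
    and "very_small E"
  shows "f \<in> RI"
proof -
  have cont_minus: "isCont (\<lambda>p. - f p) p \<longleftrightarrow> isCont f p" for p
    using continuous_minus[of "at p" f] continuous_minus[of "at p" "\<lambda>p. - f p"] by auto
  have neg: "negligible {p. \<not> isCont f p}"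
    using assms(2,3) very_small_imp_negligible by blast
  have "(\<lambda>p. - f p) \<in> BB"
    using assms(1) by (auto simp: BB_def bounded_iff)
  then have "(\<lambda>k. upper_dyadic_sum k (\<lambda>p. - f p)) \<longlonglongrightarrow> integral {p. isCont f p} (\<lambda>p. - f p)"
    using upper_dyadic_sum_tendsto_integral[of "\<lambda>p. - f p"] neg by (simp add: cont_minus)
  from tendsto_minus[OF this] have "(\<lambda>k. lower_dyadic_sum k f) \<longlonglongrightarrow> integral {p. isCont f p} f"
    by (simp add: lower_dyadic_sum_eq_upper)
  then show ?thesis
    using upper_dyadic_sum_tendsto_integral[OF assms(1) neg] assms(1) by (auto simp: RI_def)
qed

end
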